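(* For every integer $n\ge 3$, neither $\mathrm{Ind}_n$ nor $\mathrm{GST}_n$ is a convex subset of $\mathbb R^n$.
   Context: For $n\ge 2$ and $\mathbf p=(p_1,\dots,p_n)\in\mathbb R^n$ let $$\psi(\mathbf p)=\bigg(\frac{1}{2^{n-1}}\sum_{k=0}^{n-1}\binom{n-1}{k}p_{k+1}\bigg)^2-\frac{1}{2^{n-1}}\sum_{k=0}^{n-2}\binom{n-2}{k}\big(p_{k+2}^2+p_{k+1}p_{n-(k+1)}\big).$$ Put $\mathrm{Ind}_n=\{\mathbf p\in[0,1]^n:\psi(\mathbf p)=0\}$. For $x\in\{0,1\}^n$ and $1\le i\le n$ put $\pi_i(x)=p_k$ with $k=\#\{j: x_j=x_i\}$. $\mathrm{Inf}_n$ is the set of $\mathbf p\in[0,1]^n$ such that for all $1\le i,j\le n$ there is $x\in\{0,1\}^n$ with $\pi_i(x)\neq\pi_i(x')$, where $x'$ is $x$ with its $j$-th coordinate flipped. $\mathrm{GST}_n=\mathrm{Ind}_n\cap\mathrm{Inf}_n$. *)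

theory Defs
  imports "HOL-Analysis.Analysis"
begin

text \<open>
  The dimension \<open>n\<close> is \<open>CARD('n)\<close>. The coordinates \<open>p_1, ..., p_n\<close> of a vector are
  numbered along the linear order of the index type; \<open>coord p k\<close> is meaningful only
  for \<open>1 \<le> k \<le> CARD('n)\<close>, and is only used there when \<open>CARD('n) \<ge> 2\<close>.
\<close>
definition coord :: "real ^ 'n::{finite,linorder} \<Rightarrow> nat \<Rightarrow> real" where
  "coord p k = p $ (sorted_list_of_set (UNIV :: 'n set) ! (k - 1))"

definition psi :: "real ^ 'n::{finite,linorder} \<Rightarrow> real" where
  "psi p = (let n = CARD('n) in
     (1 / 2 ^ (n - 1) * (\<Sum>k = 0..n - 1. real ((n - 1) choose k) * coord p (k + 1)))\<^sup>2
     - 1 / 2 ^ (n - 1) * (\<Sum>k = 0..n - 2. real ((n - 2) choose k) *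
         ((coord p (k + 2))\<^sup>2 + coord p (k + 1) * coord p (n - (k + 1)))))"

definition unit_cube :: "(real ^ 'n) set" where
  "unit_cube = {p. \<forall>i. 0 \<le> p $ i \<and> p $ i \<le> 1}"

definition Ind_set :: "(real ^ 'n::{finite,linorder}) set" where
  "Ind_set = {p \<in> unit_cube. psi p = 0}"

text \<open>A point \<open>x\<close> of \<open>{0,1}^n\<close> is a function \<open>'n \<Rightarrow> bool\<close>.\<close>
definition pi_val :: "real ^ 'n::{finite,linorder} \<Rightarrow> 'n \<Rightarrow> ('n \<Rightarrow> bool) \<Rightarrow> real" where
  "pi_val p i x = coord p (card {j. x j = x i})"

definition flip :: "'n \<Rightarrow> ('n \<Rightarrow> bool) \<Rightarrow> ('n \<Rightarrow> bool)" where
  "flip j x = x(j := \<not> x j)"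

definition Inf_set :: "(real ^ 'n::{finite,linorder}) set" where
  "Inf_set = {p \<in> unit_cube. \<forall>i j. \<exists>x. pi_val p i x \<noteq> pi_val p i (flip j x)}"

definition GST_set :: "(real ^ 'n::{finite,linorder}) set" where
  "GST_set = Ind_set \<inter> Inf_set"

end

theory Submission
  imports Defs
begin

text \<open>
  On vectors \<open>(a, b, ..., b, c)\<close> the quadratic form degenerates to
  \<open>psi = ((a + c - 2 b)\<^sup>2 - N (c - b)\<^sup>2) / N\<^sup>2\<close> with \<open>N = 2^(n-1) = s\<^sup>2\<close>, a difference of two squares.
  A zero on each of the two lines \<open>a + c - 2 b = \<plusminus> s (c - b)\<close> gives a midpoint off both of them,
  so \<open>Ind_set\<close> is not convex. For \<open>n = 3\<close> one of the two lines consists of palindromic vectors,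
  which are not in \<open>Inf_set\<close>; hence \<open>GST_set\<close> is treated differently: it contains some \<open>p\<close>
  together with \<open>1 - p\<close>, and their midpoint is constant, hence outside \<open>Inf_set\<close>.
\<close>

definition end_vec :: "real \<Rightarrow> real \<Rightarrow> real \<Rightarrow> real ^ 'n::{finite,linorder}" where
  "end_vec a b c = (\<chi> i. let xs = sorted_list_of_set (UNIV :: 'n set) in
     if i = xs ! 0 then a else if i = xs ! (CARD('n) - 1) then c else b)"

lemma coord_end_vec:
  assumes "CARD('n) \<ge> 2" "1 \<le> k" "k \<le> CARD('n)"
  shows "coord (end_vec a b c :: real ^ 'n::{finite,linorder}) k
    = (if k = 1 then a else if k = CARD('n) then c else b)"
proof -
  let ?xs = "sorted_list_of_set (UNIV :: 'n set)"
  have len: "length ?xs = CARD('n)" and d: "distinct ?xs"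
    by simp_all
  have "?xs ! (k - 1) = ?xs ! 0 \<longleftrightarrow> k - 1 = 0"
    by (rule nth_eq_iff_index_eq[OF d]) (use len assms in linarith)+
  moreover have "?xs ! (k - 1) = ?xs ! (CARD('n) - 1) \<longleftrightarrow> k - 1 = CARD('n) - 1"
    by (rule nth_eq_iff_index_eq[OF d]) (use len assms in linarith)+
  ultimately show ?thesis
    using assms unfolding coord_def end_vec_def by (auto simp: Let_def)
qed

text \<open>With a constant interior, each binomial sum is a full row sum, a power of 2, plus
  corrections at the two end indices, where the binomial coefficient is 1.\<close>

lemma psi_end_vec:
  assumes "CARD('n) \<ge> 3"
  shows "psi (end_vec a b c :: real ^ 'n::{finite,linorder})
    = ((a + c - 2 * b)\<^sup>2 - 2 ^ (CARD('n) - 1) * (c - b)\<^sup>2) / (2 ^ (CARD('n) - 1))\<^sup>2"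
proof -
  let ?p = "end_vec a b c :: real ^ 'n::{finite,linorder}"
  obtain m where n: "CARD('n) = Suc (Suc m)" and m: "m \<ge> 1"
    using assms by (metis Suc_le_D Suc_le_mono numeral_3_eq_3 One_nat_def)
  have row: "(\<Sum>k = 0..j. real (j choose k)) = 2 ^ j" for j
    by (metis choose_row_sum atMost_atLeast0 of_nat_sum of_nat_power of_nat_numeral)
  have "(\<Sum>k = 0..Suc m. real (Suc m choose k) * coord ?p (k + 1))
      = (\<Sum>k = 0..Suc m. b * real (Suc m choose k) + (if k = 0 then a - b else 0)
           + (if k = Suc m then c - b else 0))"
    using n by (intro sum.cong) (auto simp: coord_end_vec algebra_simps)
  also have "\<dots> = 2 ^ Suc m * b + (a - b) + (c - b)"
    unfolding sum.distrib sum_distrib_left[symmetric] row by (simp add: sum.delta)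
  finally have S1: "(\<Sum>k = 0..Suc m. real (Suc m choose k) * coord ?p (k + 1))
      = 2 ^ Suc m * b + (a - b) + (c - b)" .
  have "(\<Sum>k = 0..m. real (m choose k) *
            ((coord ?p (k + 2))\<^sup>2 + coord ?p (k + 1) * coord ?p (Suc (Suc m) - (k + 1))))
      = (\<Sum>k = 0..m. 2 * b\<^sup>2 * real (m choose k) + (if k = 0 then b * (a - b) else 0)
           + (if k = m then c\<^sup>2 - b\<^sup>2 + b * (a - b) else 0))"
  proof (intro sum.cong refl)
    fix k assume "k \<in> {0..m}"
    then have k: "k \<le> m" by simp
    \<comment> \<open>The reversed factor reaches the first entry exactly at \<open>k = m\<close>.
      Since \<open>m \<ge> 1\<close>, the indices 0 and m differ, so the product is
      \<open>a * b\<close> at both ends and \<open>a * a\<close> never occurs.\<close>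
    have "coord ?p (k + 2) = (if k = m then c else b)"
      "coord ?p (k + 1) = (if k = 0 then a else b)"
      "coord ?p (Suc (Suc m) - (k + 1)) = (if k = m then a else b)"
      using k n by (auto simp: coord_end_vec)
    then show "real (m choose k) *
            ((coord ?p (k + 2))\<^sup>2 + coord ?p (k + 1) * coord ?p (Suc (Suc m) - (k + 1)))
      = 2 * b\<^sup>2 * real (m choose k) + (if k = 0 then b * (a - b) else 0)
           + (if k = m then c\<^sup>2 - b\<^sup>2 + b * (a - b) else 0)"
      using m by (auto simp: algebra_simps power2_eq_square)
  qed
  also have "\<dots> = 2 ^ Suc m * b\<^sup>2 + c\<^sup>2 - b\<^sup>2 + 2 * (b * (a - b))"
    unfolding sum.distrib sum_distrib_left[symmetric] row by (simp add: sum.delta)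
  finally have S2: "(\<Sum>k = 0..m. real (m choose k) *
            ((coord ?p (k + 2))\<^sup>2 + coord ?p (k + 1) * coord ?p (Suc (Suc m) - (k + 1))))
      = 2 ^ Suc m * b\<^sup>2 + c\<^sup>2 - b\<^sup>2 + 2 * (b * (a - b))" .
  define N :: real where "N = 2 ^ Suc m"
  have N: "N > 0" by (simp add: N_def)
  have "psi ?p = (1 / N * (N * b + (a - b) + (c - b)))\<^sup>2
      - 1 / N * (N * b\<^sup>2 + c\<^sup>2 - b\<^sup>2 + 2 * (b * (a - b)))"
    using S1 S2 by (simp only: psi_def Let_def n diff_Suc_1 N_def diff_Suc_Suc numeral_2_eq_2 minus_nat.diff_0)
  \<comment> \<open>In the expansion the terms of order 1 cancel, and those of order
    \<open>1 / N\<close> collect to \<open>- (c - b)\<^sup>2 / N\<close>.\<close>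
  also have "\<dots> = ((a + c - 2 * b)\<^sup>2 - N * (c - b)\<^sup>2) / N\<^sup>2"
    using N by (simp add: field_simps power2_eq_square)
  finally show ?thesis
    by (simp add: n N_def)
qed

lemma end_vec_in_unit_cube:
  assumes "a \<in> {0..1}" "b \<in> {0..1}" "c \<in> {0..1}"
  shows "end_vec a b c \<in> unit_cube"
  using assms by (auto simp: unit_cube_def end_vec_def Let_def)

lemma end_vec_in_Ind_set_iff:
  assumes "CARD('n) \<ge> 3" "s\<^sup>2 = 2 ^ (CARD('n) - 1)"
    "a \<in> {0..1}" "b \<in> {0..1}" "c \<in> {0..1}"
  shows "(end_vec a b c :: real ^ 'n::{finite,linorder}) \<in> Ind_set
    \<longleftrightarrow> (a + c - 2 * b)\<^sup>2 = (s * (c - b))\<^sup>2"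
  using assms by (simp add: Ind_set_def end_vec_in_unit_cube psi_end_vec power_mult_distrib)

text \<open>The witness x has coordinate i alone against all others, so \<open>pi_val\<close> reads
  the first entry a. Flipping i makes x constant and reads the last entry c; flipping any other j
  leaves a pair and reads entry 2, which is b because n is at least 3.\<close>

lemma end_vec_in_Inf_set:
  assumes n: "CARD('n) \<ge> 3" and "a \<in> {0..1}" "b \<in> {0..1}" "c \<in> {0..1}" and ne: "a \<noteq> b" "a \<noteq> c"
  shows "(end_vec a b c :: real ^ 'n::{finite,linorder}) \<in> Inf_set"
proof -
  let ?p = "end_vec a b c :: real ^ 'n::{finite,linorder}"
  have "\<exists>x. pi_val ?p i x \<noteq> pi_val ?p i (flip j x)" for i j
  proof (intro exI)
    let ?x = "\<lambda>l. l = i"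
    have 1: "pi_val ?p i ?x = a"
      using n by (simp add: pi_val_def coord_end_vec)
    have "pi_val ?p i (flip j ?x) = (if i = j then c else b)"
    proof (cases "i = j")
      case True
      then have "{l. flip j ?x l = flip j ?x i} = UNIV"
        by (auto simp: flip_def)
      then show ?thesis
        using True n by (simp add: pi_val_def coord_end_vec)
    next
      case False
      then have "{l. flip j ?x l = flip j ?x i} = {i, j}"
        by (auto simp: flip_def)
      then show ?thesis
        using False n by (simp add: pi_val_def coord_end_vec)
    qed
    with 1 ne show "pi_val ?p i ?x \<noteq> pi_val ?p i (flip j ?x)"
      by simp
  qed
  then show ?thesis
    using assms by (simp add: Inf_set_def end_vec_in_unit_cube)
qed

lemma end_vec_const_notin_Inf_set: "end_vec a a a \<notin> Inf_set"
  by (simp add: Inf_set_def pi_val_def coord_def end_vec_def Let_def)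

lemma midpoint_end_vec:
  "midpoint (end_vec a b c) (end_vec a' b' c') = end_vec ((a + a') / 2) ((b + b') / 2) ((c + c') / 2)"
  by (simp add: midpoint_def end_vec_def vec_eq_iff Let_def)

lemma midpoint_in_convex:
  assumes "convex S" "x \<in> S" "y \<in> S"
  shows "midpoint x y \<in> S"
  using closed_segment_subset[OF assms(2,3,1)] by auto

text \<open>The bound \<open>s \<ge> 2\<close> is what keeps the entry \<open>1 / (s - 1)\<close>,
  used below, inside the unit interval.\<close>

lemma ex_sqrt_power2_ge_2:
  assumes "n \<ge> 3"
  obtains s :: real where "s \<ge> 2" "s\<^sup>2 = 2 ^ (n - 1)"
proof
  have "(2::real) ^ 2 \<le> 2 ^ (n - 1)"
    using assms by (intro power_increasing) auto
  then show "sqrt (2 ^ (n - 1)) \<ge> 2"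
    by (intro real_le_rsqrt) auto
qed simp

lemma not_convex_Ind_set:
  assumes n: "CARD('n) \<ge> 3"
  shows "\<not> convex (Ind_set :: (real ^ 'n::{finite,linorder}) set)"
proof
  assume conv: "convex (Ind_set :: (real ^ 'n::{finite,linorder}) set)"
  obtain s :: real where s: "s \<ge> 2" "s\<^sup>2 = 2 ^ (CARD('n) - 1)"
    using ex_sqrt_power2_ge_2[OF n] .
  \<comment> \<open>These values solve \<open>1 + c = s * c\<close> and
    \<open>1 - 2 * b = s * b\<close>: they put (1, 0, ..., 0, c) on the line with sign + and (1, b,
    ..., b, 0) on the line with sign -.\<close>
  define c where "c = 1 / (s - 1)"
  define b where "b = 1 / (s + 2)"
  have c: "s * c = 1 + c" "c \<in> {0..1}" "c > 0" and b: "s * b = 1 - 2 * b" "b \<in> {0..1}" "b > 0"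
    using s by (auto simp: c_def b_def field_simps)
  have "(end_vec 1 0 c :: real ^ 'n::{finite,linorder}) \<in> Ind_set"
    using n c by (simp add: end_vec_in_Ind_set_iff[OF n s(2)])
  moreover have "(end_vec 1 b 0 :: real ^ 'n::{finite,linorder}) \<in> Ind_set"
    using n b by (simp add: end_vec_in_Ind_set_iff[OF n s(2)] power2_commute[of 1 "2 * b"])
  ultimately have "midpoint (end_vec 1 0 c) (end_vec 1 b 0) \<in> (Ind_set :: (real ^ 'n::{finite,linorder}) set)"
    by (rule midpoint_in_convex[OF conv])
  then have "(1 + c / 2 - b)\<^sup>2 = (s * ((c - b) / 2))\<^sup>2"
    using n b c by (simp add: midpoint_end_vec end_vec_in_Ind_set_iff[OF n s(2)] diff_divide_distrib)
  moreover have "1 + c / 2 - b = (s * c + s * b) / 2"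
    unfolding b(1) c(1) by (simp add: field_simps)
  moreover have "s * ((c - b) / 2) = (s * c - s * b) / 2"
    by (simp add: right_diff_distrib)
  ultimately have "((s * c + s * b) / 2)\<^sup>2 = ((s * c - s * b) / 2)\<^sup>2"
    by simp
  \<comment> \<open>At the midpoint the two squares differ by the product of \<open>s * c\<close>
    and \<open>s * b\<close>, both positive.\<close>
  moreover have "((x + y) / 2)\<^sup>2 - ((x - y) / 2)\<^sup>2 = x * y" for x y :: real
    by (simp add: field_simps power2_eq_square)
  ultimately have "(s * c) * (s * b) = 0"
    by (metis right_minus_eq)
  then show False
    using s b c by simp
qed

lemma not_convex_GST_set:
  assumes n: "CARD('n) \<ge> 3"
  shows "\<not> convex (GST_set :: (real ^ 'n::{finite,linorder}) set)"
proof
  assume conv: "convex (GST_set :: (real ^ 'n::{finite,linorder}) set)"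
  obtain s :: real where s: "s \<ge> 2" "s\<^sup>2 = 2 ^ (CARD('n) - 1)"
    using ex_sqrt_power2_ge_2[OF n] .
  \<comment> \<open>Again b solves \<open>1 - 2 * b = s * b\<close>. Here \<open>b < 1\<close> also
    matters: it separates the first entry from the middle ones in both vectors, as membership in
    \<open>Inf_set\<close> requires.\<close>
  define b where "b = 1 / (s + 2)"
  have b: "s * b = 1 - 2 * b" "b \<in> {0..1}" "b > 0" "b < 1"
    using s by (auto simp: b_def field_simps)
  have "(end_vec 1 b 0 :: real ^ 'n::{finite,linorder}) \<in> GST_set"
    using n b by (simp add: GST_set_def end_vec_in_Inf_set end_vec_in_Ind_set_iff[OF n s(2)]
        power2_commute[of 1 "2 * b"])
  \<comment> \<open>Replacing p by 1 - p negates both linear forms \<open>a + c - 2 * b\<close> and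
    \<open>c - b\<close>, so their squares are unchanged.\<close>
  moreover have "(1 - 2 * (1 - b))\<^sup>2 = (s * b)\<^sup>2"
    unfolding b(1) by (simp add: power2_eq_square algebra_simps)
  then have "(end_vec 0 (1 - b) 1 :: real ^ 'n::{finite,linorder}) \<in> GST_set"
    using n b by (simp add: GST_set_def end_vec_in_Inf_set end_vec_in_Ind_set_iff[OF n s(2)])
  ultimately have "midpoint (end_vec 1 b 0) (end_vec 0 (1 - b) 1) \<in> (GST_set :: (real ^ 'n::{finite,linorder}) set)"
    by (rule midpoint_in_convex[OF conv])
  then show False
    by (simp add: midpoint_end_vec GST_set_def end_vec_const_notin_Inf_set)
qed

theorem mainTheorem5:
  assumes "CARD('n) \<ge> 3"
  shows "\<not> convex (Ind_set :: (real ^ 'n::{finite,linorder}) set)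
    \<and> \<not> convex (GST_set :: (real ^ 'n::{finite,linorder}) set)"
  using not_convex_Ind_set[OF assms] not_convex_GST_set[OF assms] by blast

end
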